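(* For a perfectly normal $T_1$ space $(X,\tau)$ the following statements are equivalent: (1) $(X,\tau)$ is discrete. (2) $B_1(X)=C(X)$. (3) $B_1^*(X)=C^*(X)$. (4) $\mathcal{M}(B_1^*(X))$ is the Stone-Čech compactification of $(X,\tau)$. (5) $\mathcal{M}(B_1(X))$ is the Stone-Čech compactification of $(X,\tau)$.
   Context: $C(X)$ is the ring of continuous functions $(X,\tau)\to\mathbb{R}$ and $C^*(X)$ its subring of bounded functions. $B_1(X)$ is the ring of Baire one functions on $(X,\tau)$, i.e. pointwise limits of sequences in $C(X)$, and $B_1^*(X)$ its subring of bounded functions. A space is perfectly normal if it is normal and each closed set is a $G_\delta$ set (equivalently, each closed set is the zero set of a continuous real-valued function). For a commutative ring $R$ with unity, $\mathcal{M}(R)$ is the set of all maximal ideals of $R$ with the hull-kernel topology: the sets $\{M\in\mathcal{M}(R): a\in M\}$, $a\in R$, form a base for closed sets. For $R=B_1(X)$ or $R=B_1^*(X)$, $X$ is regarded as mapped into $\mathcal{M}(R)$ by the canonical map $x\mapsto\{f\in R: f(x)=0\}$, and the assertion that $\mathcal{M}(R)$ is the Stone-Čech compactification of $(X,\tau)$ is meant with respect to this map: $\mathcal{M}(R)$ is compact Hausdorff, the canonical map is a homeomorphism of $(X,\tau)$ onto a dense subspace of $\mathcal{M}(R)$, and every continuous map from $(X,\tau)$ to a compact Hausdorff space extends (uniquely) along the canonical map to a continuous map on $\mathcal{M}(R)$. *)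

theory Defs
  imports "HOL-Analysis.Analysis" "HOL-Algebra.Ideal"
begin

definition perfectly_normal_space :: "'a topology \<Rightarrow> bool" where
  "perfectly_normal_space X \<longleftrightarrow> normal_space X \<and> (\<forall>S. closedin X S \<longrightarrow> gdelta_in X S)"


section \<open>Continuous and Baire one functions\<close>

text \<open>
  A function on the space \<open>X\<close> is an extensional HOL function, i.e. one with value
  \<^const>\<open>undefined\<close> outside \<^term>\<open>topspace X\<close>, so that equality in the sets
  below is equality of functions on \<open>X\<close>.
\<close>

definition continuous_funs :: "'a topology \<Rightarrow> ('a \<Rightarrow> real) set" where
  "continuous_funs X = {f \<in> extensional (topspace X). continuous_map X euclideanreal f}"

definition baire_one_funs :: "'a topology \<Rightarrow> ('a \<Rightarrow> real) set" where
  "baire_one_funs X = {f \<in> extensional (topspace X).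
     \<exists>F :: nat \<Rightarrow> 'a \<Rightarrow> real. (\<forall>n. F n \<in> continuous_funs X) \<and>
       (\<forall>x \<in> topspace X. (\<lambda>n. F n x) \<longlonglongrightarrow> f x)}"

definition bounded_continuous_funs :: "'a topology \<Rightarrow> ('a \<Rightarrow> real) set" where
  "bounded_continuous_funs X = {f \<in> continuous_funs X. bounded (f ` topspace X)}"

definition bounded_baire_one_funs :: "'a topology \<Rightarrow> ('a \<Rightarrow> real) set" where
  "bounded_baire_one_funs X = {f \<in> baire_one_funs X. bounded (f ` topspace X)}"

definition function_ring :: "'a set \<Rightarrow> ('a \<Rightarrow> real) set \<Rightarrow> ('a \<Rightarrow> real) ring" where
  "function_ring S F =
     \<lparr>carrier = F,
      mult = (\<lambda>f g. \<lambda>x\<in>S. f x * g x), one = (\<lambda>x\<in>S. 1),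
      zero = (\<lambda>x\<in>S. 0), add = (\<lambda>f g. \<lambda>x\<in>S. f x + g x)\<rparr>"

definition baire_one_ring :: "'a topology \<Rightarrow> ('a \<Rightarrow> real) ring" where
  "baire_one_ring X = function_ring (topspace X) (baire_one_funs X)"

definition bounded_baire_one_ring :: "'a topology \<Rightarrow> ('a \<Rightarrow> real) ring" where
  "bounded_baire_one_ring X = function_ring (topspace X) (bounded_baire_one_funs X)"


section \<open>The maximal ideal space\<close>

definition max_ideals :: "('r, 'm) ring_scheme \<Rightarrow> 'r set set" where
  "max_ideals R = {M. maximalideal M R}"

text \<open>
  The sets \<open>{M. a \<in> M}\<close> form a base for the closed sets, that is, their complements form a
  base for the open sets.
\<close>

definition hull_kernel_topology :: "('r, 'm) ring_scheme \<Rightarrow> 'r set topology" where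
  "hull_kernel_topology R = topology (arbitrary union_of
     (\<lambda>U. \<exists>a \<in> carrier R. U = max_ideals R - {M \<in> max_ideals R. a \<in> M}))"

definition point_ideal :: "('a \<Rightarrow> real, 'm) ring_scheme \<Rightarrow> 'a \<Rightarrow> ('a \<Rightarrow> real) set" where
  "point_ideal R x = {f \<in> carrier R. f x = 0}"


section \<open>Stone-Cech compactification\<close>

text \<open>
  \<open>e\<close> exhibits \<open>B\<close> as the Stone-Cech compactification of \<open>X\<close>, the extension property being
  tested on the compact Hausdorff spaces \<open>K\<close> whose points lie in \<open>'k\<close>.  HOL cannot
  quantify over types inside a formula, hence the type argument.  The property is the usual
  one if \<open>'k\<close> is large enough: the image of \<open>X\<close> in a compact Hausdorff space has a closure of
  cardinality at most that of \<open>Pow (Pow (topspace X))\<close> (at most that of \<open>topspace X\<close> if this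
  is finite), so any \<open>'k\<close> into which \<open>('a \<Rightarrow> real) set\<close> injects suffices.
\<close>

definition stone_cech_compactification ::
  "'k itself \<Rightarrow> 'a topology \<Rightarrow> 'b topology \<Rightarrow> ('a \<Rightarrow> 'b) \<Rightarrow> bool" where
  "stone_cech_compactification _ X B e \<longleftrightarrow>
     compact_space B \<and> Hausdorff_space B \<and>
     embedding_map X B e \<and> B closure_of (e ` topspace X) = topspace B \<and>
     (\<forall>(K :: 'k topology) f.
        compact_space K \<and> Hausdorff_space K \<and> continuous_map X K f \<longrightarrow>
        (\<exists>!g. g \<in> extensional (topspace B) \<and> continuous_map B K g \<and>
              (\<forall>x \<in> topspace X. g (e x) = f x)))"


section \<open>Well-definedness\<close>

lemma istopology_hull_kernel:
  assumes "cring R"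
  shows "istopology (arbitrary union_of
     (\<lambda>U. \<exists>a \<in> carrier R. U = max_ideals R - {M \<in> max_ideals R. a \<in> M}))"
proof (rule istopology_base)
  interpret cring R by fact
  let ?D = "\<lambda>a. max_ideals R - {M \<in> max_ideals R. a \<in> M}"
  fix S T
  assume "\<exists>a \<in> carrier R. S = ?D a" "\<exists>a \<in> carrier R. T = ?D a"
  then obtain a b where ab: "a \<in> carrier R" "b \<in> carrier R" "S = ?D a" "T = ?D b"
    by blast
  have "a \<otimes>\<^bsub>R\<^esub> b \<in> M \<longleftrightarrow> a \<in> M \<or> b \<in> M" if "M \<in> max_ideals R" for M
  proof -
    have M: "maximalideal M R"
      using that by (simp add: max_ideals_def)
    then have "primeideal M R"
      by (rule maximalideal_prime)
    moreover have "ideal M R"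
      using M by (simp add: maximalideal_def)
    ultimately show ?thesis
      using ab by (meson ideal.I_l_closed ideal.I_r_closed primeideal.I_prime)
  qed
  then have "S \<inter> T = ?D (a \<otimes>\<^bsub>R\<^esub> b)"
    using ab by auto
  then show "\<exists>c \<in> carrier R. S \<inter> T = ?D c"
    using ab by blast
qed

lemma openin_hull_kernel:
  assumes "cring R"
  shows "openin (hull_kernel_topology R) = arbitrary union_of
     (\<lambda>U. \<exists>a \<in> carrier R. U = max_ideals R - {M \<in> max_ideals R. a \<in> M})"
  unfolding hull_kernel_topology_def
  by (rule topology_inverse'[OF istopology_hull_kernel[OF assms]])

lemma topspace_hull_kernel:
  assumes "cring R"
  shows "topspace (hull_kernel_topology R) = max_ideals R"
proof -
  interpret cring R by fact
  let ?D = "\<lambda>a. max_ideals R - {M \<in> max_ideals R. a \<in> M}"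
  have "\<one>\<^bsub>R\<^esub> \<notin> M" if "M \<in> max_ideals R" for M
    using that by (metis ideal.one_imp_carrier max_ideals_def maximalideal.I_notcarr
        maximalideal.axioms(1) mem_Collect_eq)
  then have "?D \<one>\<^bsub>R\<^esub> = max_ideals R"
    by auto
  then have "openin (hull_kernel_topology R) (max_ideals R)"
    unfolding openin_hull_kernel[OF assms]
    by (intro arbitrary_union_of_inc bexI[of _ "\<one>\<^bsub>R\<^esub>"]) auto
  moreover have "U \<subseteq> max_ideals R" if "openin (hull_kernel_topology R) U" for U
    using that unfolding openin_hull_kernel[OF assms] union_of_def by blast
  ultimately show ?thesis
    by (simp add: openin_subset subset_antisym)
qed

lemma cring_function_ring:
  assumes ext: "F \<subseteq> extensional S"
    and const: "\<And>c. (\<lambda>x\<in>S. c) \<in> F"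
    and add: "\<And>f g. f \<in> F \<Longrightarrow> g \<in> F \<Longrightarrow> (\<lambda>x\<in>S. f x + g x) \<in> F"
    and mult: "\<And>f g. f \<in> F \<Longrightarrow> g \<in> F \<Longrightarrow> (\<lambda>x\<in>S. f x * g x) \<in> F"
  shows "cring (function_ring S F)"
proof (intro cringI abelian_groupI comm_monoidI)
  fix f assume "f \<in> carrier (function_ring S F)"
  then have f: "f \<in> F"
    by (simp add: function_ring_def)
  have "(\<lambda>x\<in>S. (\<lambda>x\<in>S. - 1) x * f x) \<in> F"
    using mult[OF const f] .
  moreover have "(\<lambda>x\<in>S. (\<lambda>x\<in>S. (\<lambda>x\<in>S. - 1) x * f x) x + f x) = (\<lambda>x\<in>S. 0)"
    by (auto simp: fun_eq_iff)
  ultimately show "\<exists>g\<in>carrier (function_ring S F).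
      g \<oplus>\<^bsub>function_ring S F\<^esub> f = \<zero>\<^bsub>function_ring S F\<^esub>"
    by (intro bexI) (simp_all only: function_ring_def ring.simps monoid.simps partial_object.simps)
next
  fix f assume "f \<in> carrier (function_ring S F)"
  then have "f \<in> extensional S"
    using ext by (auto simp: function_ring_def)
  then show "\<zero>\<^bsub>function_ring S F\<^esub> \<oplus>\<^bsub>function_ring S F\<^esub> f = f"
    and "\<one>\<^bsub>function_ring S F\<^esub> \<otimes>\<^bsub>function_ring S F\<^esub> f = f"
    by (auto simp: function_ring_def fun_eq_iff extensional_def)
qed (auto simp: function_ring_def const add mult algebra_simps fun_eq_iff)

lemma const_in_continuous_funs: "(\<lambda>x\<in>topspace X. c) \<in> continuous_funs X"
  by (auto simp: continuous_funs_def intro: continuous_map_eq[where f = "\<lambda>_. c"])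

lemma add_in_continuous_funs:
  assumes "f \<in> continuous_funs X" "g \<in> continuous_funs X"
  shows "(\<lambda>x\<in>topspace X. f x + g x) \<in> continuous_funs X"
  using assms by (auto simp: continuous_funs_def
      intro: continuous_map_eq[where f = "\<lambda>x. f x + g x"] continuous_map_add)

lemma mult_in_continuous_funs:
  assumes "f \<in> continuous_funs X" "g \<in> continuous_funs X"
  shows "(\<lambda>x\<in>topspace X. f x * g x) \<in> continuous_funs X"
  using assms by (auto simp: continuous_funs_def
      intro: continuous_map_eq[where f = "\<lambda>x. f x * g x"] continuous_map_real_mult)

lemma const_in_baire_one_funs: "(\<lambda>x\<in>topspace X. c) \<in> baire_one_funs X"
  using const_in_continuous_funs[of c X]
  by (auto simp: baire_one_funs_def intro!: exI[of _ "\<lambda>_. \<lambda>x\<in>topspace X. c"])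

lemma add_in_baire_one_funs:
  assumes "f \<in> baire_one_funs X" "g \<in> baire_one_funs X"
  shows "(\<lambda>x\<in>topspace X. f x + g x) \<in> baire_one_funs X"
proof -
  obtain F where "\<And>n. F n \<in> continuous_funs X"
    "\<And>x. x \<in> topspace X \<Longrightarrow> (\<lambda>n::nat. F n x) \<longlonglongrightarrow> f x"
    using assms(1) unfolding baire_one_funs_def by blast
  moreover obtain G where "\<And>n. G n \<in> continuous_funs X"
    "\<And>x. x \<in> topspace X \<Longrightarrow> (\<lambda>n::nat. G n x) \<longlonglongrightarrow> g x"
    using assms(2) unfolding baire_one_funs_def by blast
  ultimately show ?thesis
    by (auto simp: baire_one_funs_def add_in_continuous_funs
        intro!: exI[of _ "\<lambda>n. \<lambda>x\<in>topspace X. F n x + G n x"] tendsto_add)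
qed

lemma mult_in_baire_one_funs:
  assumes "f \<in> baire_one_funs X" "g \<in> baire_one_funs X"
  shows "(\<lambda>x\<in>topspace X. f x * g x) \<in> baire_one_funs X"
proof -
  obtain F where "\<And>n. F n \<in> continuous_funs X"
    "\<And>x. x \<in> topspace X \<Longrightarrow> (\<lambda>n::nat. F n x) \<longlonglongrightarrow> f x"
    using assms(1) unfolding baire_one_funs_def by blast
  moreover obtain G where "\<And>n. G n \<in> continuous_funs X"
    "\<And>x. x \<in> topspace X \<Longrightarrow> (\<lambda>n::nat. G n x) \<longlonglongrightarrow> g x"
    using assms(2) unfolding baire_one_funs_def by blast
  ultimately show ?thesis
    by (auto simp: baire_one_funs_def mult_in_continuous_funs
        intro!: exI[of _ "\<lambda>n. \<lambda>x\<in>topspace X. F n x * G n x"] tendsto_mult)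
qed

lemma cring_baire_one_ring: "cring (baire_one_ring X)"
  unfolding baire_one_ring_def
  by (intro cring_function_ring const_in_baire_one_funs add_in_baire_one_funs
      mult_in_baire_one_funs) (auto simp: baire_one_funs_def)

lemma cring_bounded_baire_one_ring: "cring (bounded_baire_one_ring X)"
  unfolding bounded_baire_one_ring_def
proof (rule cring_function_ring)
  show "bounded_baire_one_funs X \<subseteq> extensional (topspace X)"
    by (auto simp: bounded_baire_one_funs_def baire_one_funs_def)
  show "(\<lambda>x\<in>topspace X. c) \<in> bounded_baire_one_funs X" for c
    using const_in_baire_one_funs[of c X]
    by (auto simp: bounded_baire_one_funs_def bounded_iff)
next
  fix f g
  assume fg: "f \<in> bounded_baire_one_funs X" "g \<in> bounded_baire_one_funs X"
  then obtain a b where ab: "\<And>x. x \<in> topspace X \<Longrightarrow> \<bar>f x\<bar> \<le> a"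
    "\<And>x. x \<in> topspace X \<Longrightarrow> \<bar>g x\<bar> \<le> b"
    by (auto simp: bounded_baire_one_funs_def bounded_iff)
  have "\<bar>f x + g x\<bar> \<le> a + b" if "x \<in> topspace X" for x
    using ab[OF that] by linarith
  then show "(\<lambda>x\<in>topspace X. f x + g x) \<in> bounded_baire_one_funs X"
    using fg by (auto simp: bounded_baire_one_funs_def bounded_iff add_in_baire_one_funs)
  have "\<bar>f x * g x\<bar> \<le> a * b" if "x \<in> topspace X" for x
    using ab[OF that] by (simp add: abs_mult mult_mono')
  then show "(\<lambda>x\<in>topspace X. f x * g x) \<in> bounded_baire_one_funs X"
    using fg by (auto simp: bounded_baire_one_funs_def bounded_iff mult_in_baire_one_funs)
qed

end

theory Submission
  imports Defs "HOL-Algebra.Ring_Divisibility"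
begin

text \<open>
  Discreteness is detected by the indicators of points.  In a perfectly normal \<open>T\<^sub>1\<close>
  space a point is an intersection of a decreasing sequence of open sets, and Urysohn functions for
  these sets converge to its indicator (\<open>indicator_point_baire_one\<close>).  So the indicator
  is a bounded Baire one function; if such functions are continuous, the point is open.  If instead
  \<open>x \<mapsto> {f. f x = 0}\<close> is merely continuous into the maximal ideal space, the point
  is open as well: the maximal ideals that do not contain the indicator of \<open>x\<close> form an
  open set, and the only point that is mapped into it is \<open>x\<close> itself.

  Conversely, on a discrete space \<open>S\<close> every function is continuous, and the two rings
  are those of all functions and of all bounded functions on \<open>S\<close>.  Both are treated
  at once through their common property that a function bounded away from zero on a set \<open>B\<close>
  has an inverse there, extended by zero.  It implies that the maximal ideal space has the
  clopen base of the sets of those \<open>M\<close> that omit the indicator of \<open>B\<close>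
  (\<open>ind_separates\<close>).  The sets whose indicator is not in \<open>M\<close> form an
  ultrafilter on \<open>S\<close>, and the maximal ideal space is the space of ultrafilters in
  disguise.  Hence it is Hausdorff, the point ideals are isolated and dense in it, and a function
  from \<open>S\<close> to a compact Hausdorff space extends to \<open>M\<close> by its limit
  along the ultrafilter of \<open>M\<close> (\<open>continuous_extension_exists\<close>).
  Compactness holds for the maximal ideal space of any commutative ring.
\<close>

section \<open>The maximal ideal space of a commutative ring\<close>

text \<open>
  Krull's theorem: by Zorn's lemma there is a maximal element among the ideals above \<open>I\<close>
  that omit the unit, since omitting the unit is preserved by unions of chains.
\<close>
lemma (in cring) ideal_extends_to_maximalideal:
  assumes "ideal I R" "\<one> \<notin> I"
  obtains M where "maximalideal M R" "I \<subseteq> M"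
proof -
  let ?A = "{J. ideal J R \<and> I \<subseteq> J \<and> \<one> \<notin> J}"
  have "\<exists>M\<in>?A. \<forall>J\<in>?A. M \<subseteq> J \<longrightarrow> J = M"
  proof (rule subset_Zorn_nonempty)
    show "?A \<noteq> {}"
      using assms by blast
  next
    fix C assume C: "C \<noteq> {}" "subset.chain ?A C"
    then have "subset.chain {I. ideal I R} C"
      unfolding subset.chain_def by blast
    from chain_Union_is_ideal[OF this] C show "\<Union>C \<in> ?A"
      unfolding subset.chain_def by auto
  qed
  then obtain M where "M \<in> ?A" and max: "\<forall>J\<in>?A. M \<subseteq> J \<longrightarrow> J = M"
    by (rule bexE)
  then have M: "ideal M R" "I \<subseteq> M" "\<one> \<notin> M"
    by simp_all
  have "maximalideal M R"
  proof (rule maximalidealI)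
    fix J assume J: "ideal J R" "M \<subseteq> J"
    show "J = M \<or> J = carrier R"
    proof (cases "\<one> \<in> J")
      case True
      then show ?thesis
        using ideal.one_imp_carrier[OF J(1)] by simp
    next
      case False
      with J M(2) have "J \<in> ?A"
        by simp
      with max J(2) show ?thesis
        by simp
    qed
  next
    show "carrier R \<noteq> M"
      using M(3) one_closed by metis
  qed (rule M(1))
  with M(2) show thesis
    by (rule that[rotated])
qed

text \<open>
  The ideals generated by the finite subsets of \<open>A\<close> are directed, so their union is an
  ideal, and it contains \<open>A\<close>.
\<close>
lemma (in cring) genideal_finite_support:
  assumes "A \<subseteq> carrier R" "a \<in> Idl A"
  obtains F where "finite F" "F \<subseteq> A" "a \<in> Idl F"
proof -
  let ?I = "\<Union>F\<in>{F. finite F \<and> F \<subseteq> A}. Idl F"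
  have id: "ideal (Idl F) R" if "F \<subseteq> A" for F
    using that assms(1) by (intro genideal_ideal) auto
  have carr: "x \<in> carrier R" if "F \<subseteq> A" "x \<in> Idl F" for F x
    by (rule ideal.Icarr[OF id]) (fact that)+
  have sub: "additive_subgroup (Idl F) R" if "F \<subseteq> A" for F
    by (rule ideal.axioms(1)[OF id[OF that]])
  have mono: "Idl F \<subseteq> Idl G" if "F \<subseteq> G" "G \<subseteq> A" for F G
    using that assms(1) by (intro subset_Idl_subset) auto
  have mem: "x \<in> ?I" if "finite F" "F \<subseteq> A" "x \<in> Idl F" for F x
    by (rule UN_I[of F]) (use that in simp_all)
  have memE: "\<exists>F. finite F \<and> F \<subseteq> A \<and> x \<in> Idl F" if "x \<in> ?I" for x
    using that by (elim UN_E) auto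
  have "ideal ?I R"
  proof (rule idealI[OF ring_axioms])
    show "subgroup ?I (add_monoid R)"
    proof (rule add.subgroupI)
      show "?I \<subseteq> carrier R"
        by (rule subsetI, drule memE) (elim exE conjE, rule carr)
      have "\<zero> \<in> Idl {}"
        by (rule additive_subgroup.zero_closed[OF sub]) simp
      with mem[of "{}" \<zero>] show "?I \<noteq> {}"
        by auto
    next
      fix x assume "x \<in> ?I"
      then obtain F where F: "finite F" "F \<subseteq> A" "x \<in> Idl F"
        using memE by blast
      then show "\<ominus> x \<in> ?I"
        by (intro mem[of F] additive_subgroup.a_inv_closed[OF sub])
    next
      fix x y assume "x \<in> ?I" "y \<in> ?I"
      then obtain F G where F: "finite F" "F \<subseteq> A" "x \<in> Idl F"
        and G: "finite G" "G \<subseteq> A" "y \<in> Idl G"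
        using memE by meson
      have FG: "finite (F \<union> G)" "F \<union> G \<subseteq> A"
        using F G by simp_all
      have "x \<in> Idl (F \<union> G)" "y \<in> Idl (F \<union> G)"
        using F(3) G(3) mono[OF _ FG(2)] by (meson Un_upper1 Un_upper2 subsetD)+
      with FG show "x \<oplus> y \<in> ?I"
        by (intro mem[of "F \<union> G"] additive_subgroup.a_closed[OF sub])
    qed
  next
    fix x r assume "x \<in> ?I" and r: "r \<in> carrier R"
    then obtain F where F: "finite F" "F \<subseteq> A" "x \<in> Idl F"
      using memE by blast
    show "r \<otimes> x \<in> ?I"
      by (rule mem[OF F(1,2) ideal.I_l_closed[OF id[OF F(2)] F(3) r]])
    show "x \<otimes> r \<in> ?I"
      by (rule mem[OF F(1,2) ideal.I_r_closed[OF id[OF F(2)] F(3) r]])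
  qed
  moreover have "A \<subseteq> ?I"
  proof
    fix b assume "b \<in> A"
    then show "b \<in> ?I"
      using assms(1) by (intro mem[of "{b}"] genideal_self') auto
  qed
  ultimately have "Idl A \<subseteq> ?I"
    by (rule genideal_minimal)
  with assms(2) have "a \<in> ?I"
    by (rule subsetD[rotated])
  with that memE show thesis
    by blast
qed

lemma openin_hull_kernel_base:
  assumes "cring R" "a \<in> carrier R"
  shows "openin (hull_kernel_topology R) {M \<in> max_ideals R. a \<notin> M}"
proof -
  have "{M \<in> max_ideals R. a \<notin> M} = max_ideals R - {M \<in> max_ideals R. a \<in> M}"
    by blast
  then show ?thesis
    unfolding openin_hull_kernel[OF assms(1)]
    using assms(2) by (intro arbitrary_union_of_inc) blast
qed

lemma openin_hull_kernel_iff: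
  assumes "cring R"
  shows "openin (hull_kernel_topology R) U \<longleftrightarrow> U \<subseteq> max_ideals R \<and>
    (\<forall>M\<in>U. \<exists>a\<in>carrier R. a \<notin> M \<and> {N \<in> max_ideals R. a \<notin> N} \<subseteq> U)" (is "?L \<longleftrightarrow> ?R")
proof
  assume L: ?L
  then have "U \<subseteq> max_ideals R"
    using openin_subset topspace_hull_kernel[OF assms] by metis
  moreover have "\<exists>a\<in>carrier R. a \<notin> M \<and> {N \<in> max_ideals R. a \<notin> N} \<subseteq> U" if "M \<in> U" for M
    using L that unfolding openin_hull_kernel[OF assms] arbitrary_union_of_alt by blast
  ultimately show ?R
    by blast
next
  assume R: ?R
  show ?L
  proof (subst openin_subopen, intro ballI)
    fix M assume M: "M \<in> U"
    then obtain a where "a \<in> carrier R" "a \<notin> M" "{N \<in> max_ideals R. a \<notin> N} \<subseteq> U"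
      using R by blast
    then show "\<exists>T. openin (hull_kernel_topology R) T \<and> M \<in> T \<and> T \<subseteq> U"
      using M R openin_hull_kernel_base[OF assms] by blast
  qed
qed

text \<open>
  Let \<open>A\<close> be the set of those elements whose basic open set lies in a member of the cover.
  No maximal ideal contains \<open>A\<close>, so by Krull's theorem \<open>A\<close> generates the
  unit ideal.  Finitely many of its elements already do, and their basic open sets cover the space.
\<close>
lemma compact_space_hull_kernel:
  fixes R (structure)
  assumes "cring R"
  shows "compact_space (hull_kernel_topology R)"
  unfolding compact_space_alt topspace_hull_kernel[OF assms]
proof (intro allI impI, elim conjE)
  interpret cring R by fact
  fix \<U>
  assume op: "\<forall>U\<in>\<U>. openin (hull_kernel_topology R) U" and cov: "max_ideals R \<subseteq> \<Union>\<U>"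
  define A where "A = {a \<in> carrier R. \<exists>U\<in>\<U>. {M \<in> max_ideals R. a \<notin> M} \<subseteq> U}"
  have A: "A \<subseteq> carrier R"
    by (auto simp: A_def)
  have "\<not> A \<subseteq> M" if M: "maximalideal M R" for M
  proof -
    have "M \<in> \<Union>\<U>"
      using M cov by (auto simp: max_ideals_def)
    then obtain U where U: "U \<in> \<U>" "M \<in> U"
      by blast
    then have "openin (hull_kernel_topology R) U"
      using op by blast
    then have "\<exists>a\<in>carrier R. a \<notin> M \<and> {N \<in> max_ideals R. a \<notin> N} \<subseteq> U"
      using U(2) unfolding openin_hull_kernel_iff[OF assms] by simp
    then obtain a where a: "a \<in> carrier R" "a \<notin> M" "{N \<in> max_ideals R. a \<notin> N} \<subseteq> U"
      by (elim bexE conjE)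
    with U(1) have "a \<in> A"
      unfolding A_def by blast
    with a(2) show ?thesis
      by blast
  qed
  then have not_sub: "maximalideal M R \<Longrightarrow> \<not> A \<subseteq> M" for M .
  have "\<one> \<in> Idl A"
  proof (rule ccontr)
    assume "\<one> \<notin> Idl A"
    with genideal_ideal[OF A] obtain M where "maximalideal M R" "Idl A \<subseteq> M"
      by (rule ideal_extends_to_maximalideal)
    then show False
      using not_sub genideal_self[OF A] by (meson order_trans)
  qed
  then obtain F where F: "finite F" "F \<subseteq> A" "\<one> \<in> Idl F"
    by (rule genideal_finite_support[OF A])
  have "\<forall>a\<in>A. \<exists>U. U \<in> \<U> \<and> {M \<in> max_ideals R. a \<notin> M} \<subseteq> U"
    unfolding A_def by blast
  then obtain u where u: "\<forall>a\<in>A. u a \<in> \<U> \<and> {M \<in> max_ideals R. a \<notin> M} \<subseteq> u a"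
    by (rule bchoice[THEN exE])
  have "max_ideals R \<subseteq> \<Union>(u ` F)"
  proof
    fix M assume M: "M \<in> max_ideals R"
    then interpret M: maximalideal M R
      by (simp add: max_ideals_def)
    have "\<not> F \<subseteq> M"
    proof
      assume "F \<subseteq> M"
      then have "\<one> \<in> M"
        using F(3) genideal_minimal[OF M.is_ideal] by (meson subsetD)
      then show False
        using M.one_imp_carrier M.I_notcarr by simp
    qed
    then obtain a where a: "a \<in> F" "a \<notin> M"
      by blast
    with F(2) u have "{M \<in> max_ideals R. a \<notin> M} \<subseteq> u a"
      by auto
    with a M show "M \<in> \<Union>(u ` F)"
      by blast
  qed
  then show "\<exists>\<F>. finite \<F> \<and> \<F> \<subseteq> \<U> \<and> max_ideals R \<subseteq> \<Union>\<F>"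
    using F u by (intro exI[of _ "u ` F"]) auto
qed


section \<open>Function rings with local inverses\<close>

text \<open>
  What the ring of all functions and the ring of all bounded functions on a discrete space share.
  The bound \<open>c\<close> makes \<open>local_inverse\<close> true in the second: the inverse is
  bounded by \<open>1 / c\<close>.  Applied to a constant, \<open>local_inverse\<close> provides the
  indicators of all subsets of \<open>S\<close>.
\<close>
locale locally_inverse_function_ring =
  fixes S :: "'a set" and F :: "('a \<Rightarrow> real) set"
  assumes ext_F: "F \<subseteq> extensional S"
    and const: "\<And>c. (\<lambda>x\<in>S. c) \<in> F"
    and add: "\<And>f g. f \<in> F \<Longrightarrow> g \<in> F \<Longrightarrow> (\<lambda>x\<in>S. f x + g x) \<in> F"
    and mult: "\<And>f g. f \<in> F \<Longrightarrow> g \<in> F \<Longrightarrow> (\<lambda>x\<in>S. f x * g x) \<in> F"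
    and local_inverse: "\<And>f B c. f \<in> F \<Longrightarrow> 0 < c \<Longrightarrow> (\<And>x. x \<in> B \<inter> S \<Longrightarrow> c \<le> \<bar>f x\<bar>) \<Longrightarrow>
          (\<lambda>x\<in>S. if x \<in> B then inverse (f x) else 0) \<in> F"
begin

abbreviation R :: "('a \<Rightarrow> real) ring" where
  "R \<equiv> function_ring S F"

abbreviation ind :: "'a set \<Rightarrow> 'a \<Rightarrow> real" where
  "ind B \<equiv> (\<lambda>x\<in>S. if x \<in> B then 1 else 0)"

abbreviation maxspec :: "('a \<Rightarrow> real) set topology" where
  "maxspec \<equiv> hull_kernel_topology R"

sublocale cring R
  by (rule cring_function_ring) (use ext_F const add mult in auto)

lemma R_simps: "carrier R = F" "f \<otimes>\<^bsub>R\<^esub> g = (\<lambda>x\<in>S. f x * g x)" "f \<oplus>\<^bsub>R\<^esub> g = (\<lambda>x\<in>S. f x + g x)"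
  "\<one>\<^bsub>R\<^esub> = (\<lambda>x\<in>S. 1)" "\<zero>\<^bsub>R\<^esub> = (\<lambda>x\<in>S. 0)"
  by (simp_all add: function_ring_def)

lemma ind_in: "ind B \<in> F"
proof -
  have "(\<lambda>x\<in>S. if x \<in> B then inverse ((\<lambda>x\<in>S. 1) x) else 0) \<in> F"
    by (rule local_inverse[OF const, of 1]) auto
  also have "(\<lambda>x\<in>S. if x \<in> B then inverse ((\<lambda>x\<in>S. 1::real) x) else 0) = ind B"
    by (rule ext) auto
  finally show ?thesis .
qed

lemma one_notin_max_ideal:
  assumes "M \<in> max_ideals R" shows "(\<lambda>x\<in>S. 1) \<notin> M"
proof -
  interpret M: maximalideal M R
    using assms by (simp add: max_ideals_def)
  show ?thesis
    using M.one_imp_carrier M.I_notcarr by (auto simp: R_simps)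
qed

lemma zero_in_max_ideal:
  assumes "M \<in> max_ideals R" shows "(\<lambda>x\<in>S. 0) \<in> M"
proof -
  interpret M: maximalideal M R
    using assms by (simp add: max_ideals_def)
  show ?thesis
    using M.zero_closed by (simp add: R_simps)
qed

lemma add_in_max_ideal:
  assumes "M \<in> max_ideals R" "f \<in> M" "g \<in> M" shows "(\<lambda>x\<in>S. f x + g x) \<in> M"
proof -
  interpret M: maximalideal M R
    using assms by (simp add: max_ideals_def)
  show ?thesis
    using M.a_closed[OF assms(2,3)] by (simp add: R_simps)
qed

lemma mult_in_max_ideal_iff:
  assumes "M \<in> max_ideals R" "f \<in> F" "g \<in> F"
  shows "(\<lambda>x\<in>S. f x * g x) \<in> M \<longleftrightarrow> f \<in> M \<or> g \<in> M"
proof -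
  have "maximalideal M R"
    using assms by (simp add: max_ideals_def)
  then interpret M: primeideal M R
    by (rule maximalideal_prime)
  show ?thesis
    using M.I_prime[of f g] M.I_l_closed[of g f] M.I_r_closed[of f g] assms by (auto simp: R_simps)
qed

lemma ind_Int_in_max_ideal_iff:
  assumes "M \<in> max_ideals R"
  shows "ind (A \<inter> B) \<in> M \<longleftrightarrow> ind A \<in> M \<or> ind B \<in> M"
proof -
  have "ind (A \<inter> B) = (\<lambda>x\<in>S. ind A x * ind B x)"
    by (rule ext) auto
  then show ?thesis
    using mult_in_max_ideal_iff[OF assms ind_in ind_in, of A B] by simp
qed

lemma ind_Compl_in_max_ideal_iff:
  assumes "M \<in> max_ideals R"
  shows "ind (- B) \<in> M \<longleftrightarrow> ind B \<notin> M"
proof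
  assume "ind (- B) \<in> M"
  moreover have "(\<lambda>x\<in>S. ind B x + ind (- B) x) = (\<lambda>x\<in>S. 1)"
    by (rule ext) auto
  ultimately show "ind B \<notin> M"
    using add_in_max_ideal[OF assms, of "ind B" "ind (- B)"] one_notin_max_ideal[OF assms] by auto
next
  assume "ind B \<notin> M"
  then show "ind (- B) \<in> M"
    using ind_Int_in_max_ideal_iff[OF assms, of B "- B"] zero_in_max_ideal[OF assms] by simp
qed

text \<open>
  As \<open>f\<close> is a unit
  modulo \<open>M\<close>, there are \<open>g\<close> and \<open>h \<in> M\<close> with
  \<open>h + g f = 1\<close>.  At every point \<open>h\<close> or \<open>g f\<close> is at least
  \<open>1/2\<close> in absolute value.  On the set \<open>B\<close> where \<open>g f\<close> is,
  it can be inverted, so the indicator of \<open>B\<close> is a multiple of \<open>f\<close>; the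
  indicator of the complement is a multiple of \<open>h\<close> and thus in \<open>M\<close>.  This
  reduces the topology of the maximal ideal space to indicators.
\<close>
lemma ind_separates:
  assumes M: "M \<in> max_ideals R" and f: "f \<in> F" "f \<notin> M"
  obtains B where "ind B \<notin> M" "\<And>N. N \<in> max_ideals R \<Longrightarrow> f \<in> N \<Longrightarrow> ind B \<in> N"
proof -
  interpret M: maximalideal M R
    using M by (simp add: max_ideals_def)
  let ?J = "M <+>\<^bsub>R\<^esub> PIdl\<^bsub>R\<^esub> f"
  have fR: "f \<in> carrier R"
    using f by (simp add: R_simps)
  have J: "ideal ?J R"
    by (rule add_ideals[OF M.is_ideal cgenideal_ideal[OF fR]])
  have "M \<subseteq> ?J"
  proof
    fix h assume h: "h \<in> M"
    have "h \<oplus>\<^bsub>R\<^esub> \<zero>\<^bsub>R\<^esub> \<in> ?J"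
      unfolding set_add_def' using h
        additive_subgroup.zero_closed[OF ideal.axioms(1)[OF cgenideal_ideal[OF fR]]] by blast
    then show "h \<in> ?J"
      using h M.Icarr by simp
  qed
  moreover have "f \<in> ?J"
  proof -
    have "\<zero>\<^bsub>R\<^esub> \<oplus>\<^bsub>R\<^esub> f \<in> ?J"
      unfolding set_add_def' using M.zero_closed cgenideal_self[OF fR] by blast
    then show ?thesis
      using fR by simp
  qed
  ultimately have "?J \<noteq> M" "M \<subseteq> ?J"
    using f(2) by blast+
  moreover have "?J \<subseteq> carrier R"
    by (rule subsetI) (rule ideal.Icarr[OF J])
  ultimately have "?J = carrier R"
    using M.I_maximal[OF J] by simp
  then have "\<one>\<^bsub>R\<^esub> \<in> ?J"
    by simp
  then obtain h g where hg: "h \<in> M" "g \<in> F" "\<one>\<^bsub>R\<^esub> = h \<oplus>\<^bsub>R\<^esub> (g \<otimes>\<^bsub>R\<^esub> f)"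
    unfolding set_add_def' cgenideal_def by (auto simp: R_simps)
  have hF: "h \<in> F"
    using hg(1) M.Icarr by (simp add: R_simps)
  have one: "h x + g x * f x = 1" if "x \<in> S" for x
    using hg(3) that by (auto simp: R_simps fun_eq_iff dest: spec[of _ x])
  define B where "B = {x. 1/2 \<le> \<bar>g x * f x\<bar>}"
  define k where "k = (\<lambda>x\<in>S. if x \<in> - B then inverse (h x) else 0)"
  have "k \<in> F"
    unfolding k_def
  proof (rule local_inverse[OF hF])
    fix x assume "x \<in> - B \<inter> S"
    then show "1/2 \<le> \<bar>h x\<bar>"
      using one[of x] by (auto simp: B_def)
  qed simp
  moreover have "ind (- B) = (\<lambda>x\<in>S. k x * h x)"
  proof (rule ext)
    fix x
    have "h x \<noteq> 0" if "x \<in> S" "x \<notin> B"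
      using one[OF that(1)] that(2) by (auto simp: B_def)
    then show "ind (- B) x = (\<lambda>x\<in>S. k x * h x) x"
      by (auto simp: k_def)
  qed
  ultimately have "ind (- B) \<in> M"
    using mult_in_max_ideal_iff[OF M _ hF, of k] hg(1) by simp
  then have 1: "ind B \<notin> M"
    using ind_Compl_in_max_ideal_iff[OF M] by simp
  define p where "p = (\<lambda>x\<in>S. g x * f x)"
  define q where "q = (\<lambda>x\<in>S. if x \<in> B then inverse (p x) else 0)"
  have "q \<in> F"
    unfolding q_def
  proof (rule local_inverse)
    show "p \<in> F"
      unfolding p_def by (rule mult[OF hg(2) f(1)])
    show "1/2 \<le> \<bar>p x\<bar>" if "x \<in> B \<inter> S" for x
      using that by (auto simp: B_def p_def)
  qed simp
  then have qg: "(\<lambda>x\<in>S. q x * g x) \<in> F"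
    by (rule mult[OF _ hg(2)])
  have "ind B = (\<lambda>x\<in>S. (\<lambda>x\<in>S. q x * g x) x * f x)"
  proof (rule ext)
    fix x
    have "f x \<noteq> 0" "g x \<noteq> 0" if "x \<in> B"
      using that by (auto simp: B_def)
    then show "ind B x = (\<lambda>x\<in>S. (\<lambda>x\<in>S. q x * g x) x * f x) x"
      by (auto simp: q_def p_def field_simps)
  qed
  then have 2: "ind B \<in> N" if "N \<in> max_ideals R" "f \<in> N" for N
    using mult_in_max_ideal_iff[OF that(1) qg f(1)] that(2) by simp
  from 1 2 show thesis
    by (rule that)
qed

lemma openin_maxspec_ind: "openin maxspec {M \<in> max_ideals R. ind B \<notin> M}"
  by (rule openin_hull_kernel_base) (simp_all add: cring_axioms R_simps ind_in)

lemma openin_maxspecE: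
  assumes "openin maxspec U" "M \<in> U"
  obtains B where "ind B \<notin> M" "{N \<in> max_ideals R. ind B \<notin> N} \<subseteq> U"
proof -
  have M: "M \<in> max_ideals R"
    and "\<exists>f\<in>carrier R. f \<notin> M \<and> {N \<in> max_ideals R. f \<notin> N} \<subseteq> U"
    using assms unfolding openin_hull_kernel_iff[OF cring_axioms] by blast+
  then obtain f where f: "f \<in> F" "f \<notin> M" "{N \<in> max_ideals R. f \<notin> N} \<subseteq> U"
    unfolding R_simps by (elim bexE conjE)
  obtain B where "ind B \<notin> M" "\<And>N. N \<in> max_ideals R \<Longrightarrow> f \<in> N \<Longrightarrow> ind B \<in> N"
    using ind_separates[OF M f(1,2)] by blast
  with f(3) show thesis
    by (intro that[of B]) blast+
qed

lemma Hausdorff_space_maxspec: "Hausdorff_space maxspec"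
proof -
  have sep: "\<exists>U V. openin maxspec U \<and> openin maxspec V \<and> M \<in> U \<and> N \<in> V \<and> disjnt U V"
    if MN: "M \<in> max_ideals R" "N \<in> max_ideals R" and f: "f \<in> N" "f \<notin> M" for M N f
  proof -
    interpret N: maximalideal N R
      using MN by (simp add: max_ideals_def)
    have "f \<in> F"
      using f N.Icarr by (simp add: R_simps)
    from ind_separates[OF MN(1) this f(2)] MN(2) f(1)
    obtain B where B: "ind B \<notin> M" "ind B \<in> N"
      by blast
    then have "ind (- B) \<notin> N"
      using ind_Compl_in_max_ideal_iff[OF MN(2)] by blast
    moreover have "disjnt {M \<in> max_ideals R. ind B \<notin> M} {M \<in> max_ideals R. ind (- B) \<notin> M}"
      using ind_Compl_in_max_ideal_iff by (auto simp: disjnt_def)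
    ultimately show ?thesis
      using openin_maxspec_ind B(1) MN by blast
  qed
  show ?thesis
    unfolding Hausdorff_space_def topspace_hull_kernel[OF cring_axioms]
  proof (intro allI impI, elim conjE)
    fix M N assume MN: "M \<in> max_ideals R" "N \<in> max_ideals R" "M \<noteq> N"
    then have "(\<exists>f. f \<in> N \<and> f \<notin> M) \<or> (\<exists>f. f \<in> M \<and> f \<notin> N)"
      by blast
    then show "\<exists>U V. openin maxspec U \<and> openin maxspec V \<and> M \<in> U \<and> N \<in> V \<and> disjnt U V"
    proof (elim disjE exE conjE)
      fix f assume "f \<in> M" "f \<notin> N"
      from sep[OF MN(2,1) this] show ?thesis
        by (meson disjnt_sym)
    qed (rule sep[OF MN(1,2)])
  qed
qed

lemma point_ideal_in_max_ideals:
  assumes x: "x \<in> S" shows "point_ideal R x \<in> max_ideals R"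
  unfolding max_ideals_def mem_Collect_eq
proof (rule maximalidealI)
  have ominus: "\<ominus>\<^bsub>R\<^esub> f = (\<lambda>x\<in>S. - f x)" if "f \<in> F" for f
  proof (rule add.inv_equality)
    have "(\<lambda>x\<in>S. (\<lambda>x\<in>S. - 1) x * f x) \<in> F"
      by (rule mult[OF const that])
    moreover have "(\<lambda>x\<in>S. (\<lambda>x\<in>S. - 1) x * f x) = (\<lambda>x\<in>S. - f x)"
      by (rule ext) auto
    ultimately show "(\<lambda>x\<in>S. - f x) \<in> carrier R"
      by (simp add: R_simps)
    show "(\<lambda>x\<in>S. - f x) \<oplus>\<^bsub>R\<^esub> f = \<zero>\<^bsub>R\<^esub>"
      by (rule ext) (auto simp: R_simps)
  qed (use that in \<open>simp add: R_simps\<close>)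
  show "ideal (point_ideal R x) R"
  proof (rule idealI[OF ring_axioms])
    show "subgroup (point_ideal R x) (add_monoid R)"
    proof (rule add.subgroupI)
      show "point_ideal R x \<subseteq> carrier R"
        by (auto simp: point_ideal_def)
      have "\<zero>\<^bsub>R\<^esub> \<in> point_ideal R x"
        unfolding point_ideal_def mem_Collect_eq using x zero_closed by (simp add: R_simps)
      then show "point_ideal R x \<noteq> {}"
        by blast
    next
      fix f assume f: "f \<in> point_ideal R x"
      then have "\<ominus>\<^bsub>R\<^esub> f \<in> carrier R"
        by (intro a_inv_closed) (simp add: point_ideal_def)
      with f show "\<ominus>\<^bsub>R\<^esub> f \<in> point_ideal R x"
        using x ominus[of f] by (auto simp: point_ideal_def R_simps)
    next
      fix f g assume "f \<in> point_ideal R x" "g \<in> point_ideal R x"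
      then show "f \<oplus>\<^bsub>R\<^esub> g \<in> point_ideal R x"
        using x add[of f g] by (auto simp: point_ideal_def R_simps)
    qed
  next
    fix f g assume "f \<in> point_ideal R x" "g \<in> carrier R"
    then show "g \<otimes>\<^bsub>R\<^esub> f \<in> point_ideal R x" "f \<otimes>\<^bsub>R\<^esub> g \<in> point_ideal R x"
      using x mult[of f g] mult[of g f] by (auto simp: point_ideal_def R_simps)
  qed
  have "(\<lambda>x\<in>S. 1) \<in> carrier R - point_ideal R x"
    using const[of 1] x by (auto simp: R_simps point_ideal_def)
  then show "carrier R \<noteq> point_ideal R x"
    by blast
next
  fix J assume J: "ideal J R" "point_ideal R x \<subseteq> J"
  interpret J: ideal J R by fact
  show "J = point_ideal R x \<or> J = carrier R"
  proof (cases "J = point_ideal R x")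
    case False
    then obtain f where f: "f \<in> J" "f \<notin> point_ideal R x"
      using J by blast
    then have fF: "f \<in> F" and fx: "f x \<noteq> 0"
      using J.Icarr by (auto simp: R_simps point_ideal_def)
    \<comment> \<open>Scale \<open>f\<close> to the value 1 at \<open>x\<close>; the difference of the unit and the scaled
      function then vanishes at \<open>x\<close> and lies in \<open>J\<close>, hence so does the unit.\<close>
    define u where "u = (\<lambda>y\<in>S. (\<lambda>y\<in>S. inverse (f x)) y * f y)"
    define v where "v = (\<lambda>y\<in>S. (\<lambda>y\<in>S. 1) y + (\<lambda>y\<in>S. (\<lambda>y\<in>S. - 1) y * u y) y)"
    have uJ: "u \<in> J"
      using J.I_l_closed[OF f(1), of "\<lambda>y\<in>S. inverse (f x)"] const
      by (simp add: R_simps u_def)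
    then have "u \<in> F"
      using J.Icarr by (simp add: R_simps)
    then have "v \<in> F"
      unfolding v_def by (intro add mult const)
    moreover have "v x = 0"
      using x fx by (simp add: v_def u_def)
    ultimately have "v \<in> J"
      using J by (auto simp: point_ideal_def R_simps)
    with uJ have "u \<oplus>\<^bsub>R\<^esub> v \<in> J"
      by simp
    moreover have "u \<oplus>\<^bsub>R\<^esub> v = \<one>\<^bsub>R\<^esub>"
      by (rule ext) (auto simp: R_simps v_def)
    ultimately show ?thesis
      using J.one_imp_carrier by simp
  qed simp
qed

lemma ind_in_point_ideal_iff:
  assumes "x \<in> S" shows "ind B \<in> point_ideal R x \<longleftrightarrow> x \<notin> B"
  unfolding point_ideal_def R_simps using assms ind_in[of B] by simp

text \<open>
  If \<open>f \<in> M\<close> did not vanish at \<open>x\<close>, the indicator of \<open>x\<close> would be a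
  multiple of \<open>f\<close>.
\<close>
lemma max_ideal_eq_point_ideal:
  assumes M: "M \<in> max_ideals R" and x: "x \<in> S" and ind: "ind {x} \<notin> M"
  shows "M = point_ideal R x"
proof -
  interpret M: maximalideal M R
    using M by (simp add: max_ideals_def)
  interpret P: maximalideal "point_ideal R x" R
    using point_ideal_in_max_ideals[OF x] by (simp add: max_ideals_def)
  have "M \<subseteq> point_ideal R x"
  proof
    fix f assume f: "f \<in> M"
    then have fF: "f \<in> F"
      using M.Icarr by (simp add: R_simps)
    have "f x = 0"
    proof (rule ccontr)
      assume "f x \<noteq> 0"
      define u where "u = (\<lambda>y\<in>S. (\<lambda>y\<in>S. inverse (f x)) y * ind {x} y)"
      have "u \<in> F"
        unfolding u_def by (intro mult const ind_in)
      then have "(\<lambda>y\<in>S. u y * f y) \<in> M"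
        using mult_in_max_ideal_iff[OF M _ fF] f by simp
      moreover have "(\<lambda>y\<in>S. u y * f y) = ind {x}"
        by (rule ext) (use \<open>f x \<noteq> 0\<close> in \<open>auto simp: u_def\<close>)
      ultimately show False
        using ind by simp
    qed
    with fF show "f \<in> point_ideal R x"
      by (simp add: point_ideal_def R_simps)
  qed
  moreover have "point_ideal R x \<subseteq> carrier R"
    unfolding point_ideal_def by (rule Collect_restrict)
  ultimately have "point_ideal R x = M \<or> point_ideal R x = carrier R"
    by (rule M.I_maximal[OF P.is_ideal])
  then show ?thesis
    using P.I_notcarr by metis
qed

lemma openin_maxspec_point:
  assumes "x \<in> S" shows "openin maxspec {point_ideal R x}"
proof -
  have "M \<in> max_ideals R \<and> ind {x} \<notin> M \<longleftrightarrow> M = point_ideal R x" for M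
  proof
    assume "M \<in> max_ideals R \<and> ind {x} \<notin> M"
    then show "M = point_ideal R x"
      by (elim conjE) (rule max_ideal_eq_point_ideal[OF _ assms])
  next
    assume "M = point_ideal R x"
    then show "M \<in> max_ideals R \<and> ind {x} \<notin> M"
      using point_ideal_in_max_ideals[OF assms] ind_in_point_ideal_iff[OF assms, of "{x}"] by simp
  qed
  then have "{M \<in> max_ideals R. ind {x} \<notin> M} = {point_ideal R x}"
    by simp
  then show ?thesis
    using openin_maxspec_ind[of "{x}"] by simp
qed

lemma embedding_map_point_ideal: "embedding_map (discrete_topology S) maxspec (point_ideal R)"
proof (rule injective_open_imp_embedding_map)
  show "continuous_map (discrete_topology S) maxspec (point_ideal R)"
    using point_ideal_in_max_ideals by (auto simp: topspace_hull_kernel[OF cring_axioms])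
  show "open_map (discrete_topology S) maxspec (point_ideal R)"
    unfolding open_map_def
  proof (intro allI impI)
    fix U assume "openin (discrete_topology S) U"
    then have U: "U \<subseteq> S"
      by simp
    have "openin maxspec (\<Union>x\<in>U. {point_ideal R x})"
      using U openin_maxspec_point by (intro openin_Union) blast
    then show "openin maxspec (point_ideal R ` U)"
      by (simp add: UNION_singleton_eq_range)
  qed
  show "inj_on (point_ideal R) (topspace (discrete_topology S))"
  proof (rule inj_onI)
    fix x y assume "x \<in> topspace (discrete_topology S)" "y \<in> topspace (discrete_topology S)"
      and "point_ideal R x = point_ideal R y"
    then show "x = y"
      using ind_in_point_ideal_iff[of x "{x}"] ind_in_point_ideal_iff[of y "{x}"] by auto
  qed
qed

text \<open>
  A nonempty basic open set is given by the indicator of a nonempty \<open>B\<close>, and it contains the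
  ideals of the points of \<open>B\<close>.
\<close>
lemma dense_point_ideals: "maxspec closure_of (point_ideal R ` S) = topspace maxspec"
proof (rule dense_intersects_open[THEN iffD2], rule allI, rule impI)
  fix U assume "openin maxspec U \<and> U \<noteq> {}"
  then have U: "openin maxspec U" "U \<noteq> {}"
    by simp_all
  from U(2) obtain M where M: "M \<in> U"
    by auto
  then have "M \<in> max_ideals R"
    using openin_subset[OF U(1)] M by (auto simp: topspace_hull_kernel[OF cring_axioms])
  obtain B where B: "ind B \<notin> M" "{N \<in> max_ideals R. ind B \<notin> N} \<subseteq> U"
    using openin_maxspecE[OF U(1) M] .
  have "\<exists>x\<in>S. x \<in> B"
  proof (rule ccontr)
    assume "\<not> ?thesis"
    then have "ind B = (\<lambda>x\<in>S. 0)"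
      by (intro ext) auto
    with B(1) zero_in_max_ideal[OF \<open>M \<in> max_ideals R\<close>] show False
      by simp
  qed
  then obtain x where x: "x \<in> S" "x \<in> B"
    by blast
  then have "point_ideal R x \<in> U"
    using B(2) point_ideal_in_max_ideals[OF x(1)] ind_in_point_ideal_iff[OF x(1), of B] by auto
  with x(1) show "point_ideal R ` S \<inter> U \<noteq> {}"
    by blast
qed

text \<open>
  The value at \<open>M\<close> is a cluster point of \<open>f\<close> along the ultrafilter of the sets
  whose indicator is not in \<open>M\<close>; it exists by compactness.  The ultrafilter property makes it
  a limit: the preimage of any neighbourhood belongs to the ultrafilter (\<open>nbhd\<close>).  With the
  regularity of \<open>K\<close> this gives continuity.
\<close>
lemma continuous_extension_exists:
  fixes K :: "'k topology"
  assumes K: "compact_space K" "Hausdorff_space K" and f: "f \<in> S \<rightarrow> topspace K"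
  obtains g where "continuous_map maxspec K g" "\<And>x. x \<in> S \<Longrightarrow> g (point_ideal R x) = f x"
proof -
  have nonempty: "\<exists>y. y \<in> topspace K \<and> (\<forall>A. A \<subseteq> S \<longrightarrow> ind A \<notin> M \<longrightarrow> y \<in> K closure_of (f ` A))"
    if M: "M \<in> max_ideals R" for M
  proof -
    let ?C = "(\<lambda>A. K closure_of (f ` A)) ` {A. A \<subseteq> S \<and> ind A \<notin> M}"
    have S: "ind S \<notin> M"
    proof -
      have "ind S = (\<lambda>x\<in>S. 1)"
        by (rule ext) auto
      then show ?thesis
        using one_notin_max_ideal[OF M] by simp
    qed
    have "\<Inter>?C \<noteq> {}"
    proof (rule compact_space_fip[THEN iffD1, OF K(1), rule_format], intro conjI allI impI ballI)
      show "closedin K C" if "C \<in> ?C" for C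
        using that by auto
    next
      fix \<F> assume "finite \<F> \<and> \<F> \<subseteq> ?C"
      then obtain \<A> where \<A>: "finite \<A>" "\<A> \<subseteq> {A. A \<subseteq> S \<and> ind A \<notin> M}" "\<F> = (\<lambda>A. K closure_of (f ` A)) ` \<A>"
        using finite_subset_image[of \<F> "\<lambda>A. K closure_of (f ` A)" "{A. A \<subseteq> S \<and> ind A \<notin> M}"]
        by (elim conjE) blast
      from \<A>(1,2) have *: "ind (S \<inter> \<Inter>\<A>) \<notin> M"
      proof (induction \<A>)
        case empty
        show ?case
          using S unfolding Inter_empty Int_UNIV_right .
      next
        case (insert A \<A>)
        have "S \<inter> \<Inter>(insert A \<A>) = A \<inter> (S \<inter> \<Inter>\<A>)"
          by auto
        moreover have "ind A \<notin> M"
          using insert.prems by blast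
        moreover have "ind (S \<inter> \<Inter>\<A>) \<notin> M"
          using insert.IH insert.prems by blast
        ultimately show ?case
          using ind_Int_in_max_ideal_iff[OF M, of A "S \<inter> \<Inter>\<A>"] by metis
      qed
      have "S \<inter> \<Inter>\<A> \<noteq> {}"
      proof
        assume "S \<inter> \<Inter>\<A> = {}"
        with * zero_in_max_ideal[OF M] show False
          by simp
      qed
      then obtain x where x: "x \<in> S" "\<And>A. A \<in> \<A> \<Longrightarrow> x \<in> A"
        by blast
      have "f x \<in> K closure_of (f ` A)" if "A \<in> \<A>" for A
      proof -
        have "f ` A \<subseteq> topspace K"
          using f \<A>(2) that by blast
        then show ?thesis
          using closure_of_subset x(2)[OF that] by blast
      qed
      then show "\<Inter>\<F> \<noteq> {}"
        using \<A>(3) by blast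
    qed
    then obtain y where y: "y \<in> \<Inter>?C"
      by blast
    then have "y \<in> K closure_of (f ` S)"
      using S by blast
    then have "y \<in> topspace K"
      using closure_of_subset_topspace by (rule subsetD[rotated])
    with y show ?thesis
      by blast
  qed
  then have "\<forall>M\<in>max_ideals R. \<exists>y. y \<in> topspace K \<and>
      (\<forall>A. A \<subseteq> S \<longrightarrow> ind A \<notin> M \<longrightarrow> y \<in> K closure_of (f ` A))"
    by (rule ballI)
  from bchoice[OF this] obtain g where "\<forall>M\<in>max_ideals R. g M \<in> topspace K \<and>
      (\<forall>A. A \<subseteq> S \<longrightarrow> ind A \<notin> M \<longrightarrow> g M \<in> K closure_of (f ` A))"
    by (rule exE)
  then have g: "g M \<in> topspace K"
      "\<And>A. A \<subseteq> S \<Longrightarrow> ind A \<notin> M \<Longrightarrow> g M \<in> K closure_of (f ` A)" if "M \<in> max_ideals R" for M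
    using that by blast+
  have nbhd: "ind {x \<in> S. f x \<in> W} \<notin> M"
    if M: "M \<in> max_ideals R" and W: "openin K W" "g M \<in> W" for M W
  proof
    assume "ind {x \<in> S. f x \<in> W} \<in> M"
    moreover have "ind (- {x \<in> S. f x \<in> W}) = ind {x \<in> S. f x \<notin> W}"
      by (rule ext) auto
    ultimately have "ind {x \<in> S. f x \<notin> W} \<notin> M"
      using ind_Compl_in_max_ideal_iff[OF M, of "{x \<in> S. f x \<in> W}"] by simp
    then have "g M \<in> K closure_of (f ` {x \<in> S. f x \<notin> W})"
      using g(2)[OF M] by simp
    also have "\<dots> \<subseteq> topspace K - W"
      using f W(1) by (intro closure_of_minimal) auto
    finally show False
      using W(2) by blast
  qed
  have "continuous_map maxspec K g"
    unfolding continuous_map topspace_hull_kernel[OF cring_axioms]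
  proof (intro conjI allI impI)
    show "g ` max_ideals R \<subseteq> topspace K"
      using g by blast
  next
    fix W assume W: "openin K W"
    show "openin maxspec {M \<in> max_ideals R. g M \<in> W}"
    proof (subst openin_subopen, intro ballI)
      fix M assume "M \<in> {M \<in> max_ideals R. g M \<in> W}"
      then have M: "M \<in> max_ideals R" "g M \<in> W"
        by auto
      obtain V C where V: "openin K V" "closedin K C" "g M \<in> V" "V \<subseteq> C" "C \<subseteq> W"
        using compact_Hausdorff_imp_regular_space[OF K] W M(2)
        unfolding neighbourhood_base_of_closedin[symmetric] neighbourhood_base_of by metis
      let ?A = "{x \<in> S. f x \<in> V}"
      have "g N \<in> W" if "N \<in> max_ideals R" "ind ?A \<notin> N" for N
      proof -
        have "g N \<in> K closure_of (f ` ?A)"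
          using g(2)[OF that(1) _ that(2)] by blast
        also have "\<dots> \<subseteq> C"
          using V by (intro closure_of_minimal) auto
        finally show ?thesis
          using V by blast
      qed
      then show "\<exists>T. openin maxspec T \<and> M \<in> T \<and> T \<subseteq> {M \<in> max_ideals R. g M \<in> W}"
        using openin_maxspec_ind[of ?A] nbhd[OF M(1) V(1,3)] M(1)
        by (intro exI[of _ "{M \<in> max_ideals R. ind ?A \<notin> M}"]) blast
    qed
  qed
  moreover have "g (point_ideal R x) = f x" if x: "x \<in> S" for x
  proof -
    have "ind {x} \<notin> point_ideal R x"
      using ind_in_point_ideal_iff[OF x, of "{x}"] by blast
    from g(2)[OF point_ideal_in_max_ideals[OF x] _ this]
    have "g (point_ideal R x) \<in> K closure_of (f ` {x})"
      using x by blast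
    moreover have "closedin K {f x}"
      using closedin_Hausdorff_singleton[OF K(2)] f x by blast
    ultimately show ?thesis
      by (simp add: closure_of_closedin)
  qed
  ultimately show thesis
    by (rule that)
qed

theorem stone_cech_maxspec:
  "stone_cech_compactification TYPE('k) (discrete_topology S) maxspec (point_ideal R)"
  unfolding stone_cech_compactification_def
proof (intro conjI allI impI)
  show "compact_space maxspec"
    by (rule compact_space_hull_kernel[OF cring_axioms])
  show "Hausdorff_space maxspec"
    by (rule Hausdorff_space_maxspec)
  show "embedding_map (discrete_topology S) maxspec (point_ideal R)"
    by (rule embedding_map_point_ideal)
  show "maxspec closure_of (point_ideal R ` topspace (discrete_topology S)) = topspace maxspec"
    using dense_point_ideals by simp
next
  fix K :: "'k topology" and f
  assume "compact_space K \<and> Hausdorff_space K \<and> continuous_map (discrete_topology S) K f"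
  then have K: "compact_space K" "Hausdorff_space K" and f: "f \<in> S \<rightarrow> topspace K"
    by auto
  obtain g where g: "continuous_map maxspec K g" "\<And>x. x \<in> S \<Longrightarrow> g (point_ideal R x) = f x"
    using continuous_extension_exists[OF K f] by blast
  have mem: "point_ideal R x \<in> topspace maxspec" if "x \<in> S" for x
    using point_ideal_in_max_ideals[OF that] by (simp add: topspace_hull_kernel[OF cring_axioms])
  let ?P = "\<lambda>g. g \<in> extensional (topspace maxspec) \<and> continuous_map maxspec K g \<and>
          (\<forall>x\<in>topspace (discrete_topology S). g (point_ideal R x) = f x)"
  have ex: "?P (restrict g (topspace maxspec))"
  proof (intro conjI ballI)
    show "continuous_map maxspec K (restrict g (topspace maxspec))"
      using g(1) by (rule continuous_map_eq) simp
    fix x assume "x \<in> topspace (discrete_topology S)"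
    then show "restrict g (topspace maxspec) (point_ideal R x) = f x"
      using g(2) mem by simp
  qed (rule restrict_extensional)
  have unique: "h = restrict g (topspace maxspec)" if h: "?P h" for h
  proof (rule extensionalityI)
    show "h \<in> extensional (topspace maxspec)" "restrict g (topspace maxspec) \<in> extensional (topspace maxspec)"
      using h by simp_all
    fix M assume M: "M \<in> topspace maxspec"
    have "h M = g M"
    proof (rule forall_in_closure_of_eq[OF _ K(2) _ g(1)])
      show "M \<in> maxspec closure_of (point_ideal R ` S)"
        using M dense_point_ideals by simp
      show "continuous_map maxspec K h"
        using h by simp
      show "h N = g N" if "N \<in> point_ideal R ` S" for N
        using h g(2) that by auto
    qed
    with M show "h M = restrict g (topspace maxspec) M"
      by simp
  qed
  from ex unique show "\<exists>!g. ?P g"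
    by (rule ex1I)
qed

end


section \<open>Isolated points and Baire one functions\<close>

text \<open>
  For \<open>{x} = (\<Inter>n. U n)\<close> with decreasing open \<open>U n\<close>, take continuous
  functions with value 1 at \<open>x\<close> and 0 off \<open>U n\<close>.  At \<open>y \<noteq> x\<close> they
  vanish as soon as \<open>U n\<close> omits \<open>y\<close>.
\<close>
lemma indicator_point_baire_one:
  assumes "perfectly_normal_space X" "t1_space X" "x \<in> topspace X"
  shows "(\<lambda>y\<in>topspace X. if y = x then 1 else 0) \<in> bounded_baire_one_funs X"
proof -
  have x: "closedin X {x}"
    using assms(2,3) by (simp add: t1_space_closedin_singleton)
  then have "gdelta_in X {x}"
    using assms(1) by (simp add: perfectly_normal_space_def)
  then obtain U where U: "\<And>n. openin X (U n)" "\<And>n. U (Suc n) \<subseteq> U n" "\<Inter>(range U) = {x}"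
    unfolding gdelta_in_descending by blast
  have "\<exists>f. continuous_map X euclideanreal f \<and> f ` {x} \<subseteq> {1} \<and> f ` (topspace X - U n) \<subseteq> {0}" for n
  proof -
    have "disjnt {x} (topspace X - U n)"
      using U(3) by (auto simp: disjnt_def)
    then show ?thesis
      using Urysohn_lemma_alt[of X "{x}" "topspace X - U n" 1 0] x U(1)[of n] assms(1)
      by (metis closedin_diff closedin_topspace perfectly_normal_space_def)
  qed
  then have "\<forall>n. \<exists>f. continuous_map X euclideanreal f \<and> f ` {x} \<subseteq> {1} \<and> f ` (topspace X - U n) \<subseteq> {0}"
    by (rule allI)
  from choice[OF this] obtain f where "\<forall>n. continuous_map X euclideanreal (f n) \<and>
      f n ` {x} \<subseteq> {1} \<and> f n ` (topspace X - U n) \<subseteq> {0}"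
    by (rule exE)
  then have f: "\<And>n. continuous_map X euclideanreal (f n)" "\<And>n. f n x = 1"
      "\<And>n y. y \<in> topspace X - U n \<Longrightarrow> f n y = 0"
    by (simp_all add: image_subset_iff)
  define F where "F n = restrict (f n) (topspace X)" for n
  have "F n \<in> continuous_funs X" for n
    unfolding continuous_funs_def F_def using f(1) by (auto intro: continuous_map_eq)
  moreover have "(\<lambda>n. F n y) \<longlonglongrightarrow> (if y = x then 1 else 0)" if y: "y \<in> topspace X" for y
  proof (cases "y = x")
    case True
    then show ?thesis
      using f(2) y by (simp add: F_def)
  next
    case False
    then obtain m where m: "y \<notin> U m"
      using U(3) by blast
    have "y \<notin> U n" if "m \<le> n" for n
      using lift_Suc_antimono_le[of U, OF U(2) that] m by blast
    then have "\<forall>\<^sub>F n in sequentially. F n y = 0"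
      using f(3) y by (intro eventually_sequentiallyI[of m]) (simp add: F_def)
    then show ?thesis
      using False by (simp add: tendsto_eventually)
  qed
  ultimately have "(\<lambda>y\<in>topspace X. if y = x then 1 else 0) \<in> baire_one_funs X"
    unfolding baire_one_funs_def by (intro CollectI conjI exI[of _ F] allI ballI) simp_all
  moreover have "bounded ((\<lambda>y\<in>topspace X. if y = x then 1 else 0 :: real) ` topspace X)"
    by (auto simp: bounded_iff intro!: exI[of _ 1])
  ultimately show ?thesis
    by (simp add: bounded_baire_one_funs_def)
qed

lemma discrete_if_bounded_baire_one_continuous:
  assumes "perfectly_normal_space X" "t1_space X"
    and "bounded_baire_one_funs X \<subseteq> continuous_funs X"
  shows "X = discrete_topology (topspace X)"
proof -
  have "openin X {x}" if x: "x \<in> topspace X" for x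
  proof -
    let ?i = "\<lambda>y\<in>topspace X. if y = x then 1 else 0 :: real"
    have "continuous_map X euclideanreal ?i"
      using indicator_point_baire_one[OF assms(1,2) x] assms(3) by (auto simp: continuous_funs_def)
    then have "openin X {y \<in> topspace X. ?i y \<in> {0<..}}"
      by (rule openin_continuous_map_preimage) auto
    moreover have "{y \<in> topspace X. ?i y \<in> {0<..}} = {x}"
      using x by auto
    ultimately show ?thesis
      by simp
  qed
  then show ?thesis
    by (metis discrete_topology_unique)
qed

lemma stone_cech_compactification_imp_continuous_map:
  assumes "stone_cech_compactification TYPE('k) X B e"
  shows "continuous_map X B e"
proof -
  have "embedding_map X B e"
    using assms by (simp add: stone_cech_compactification_def)
  then have "continuous_map X (subtopology B (e ` topspace X)) e"
    unfolding embedding_map_def by (rule homeomorphic_imp_continuous_map)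
  then show ?thesis
    by (rule continuous_map_into_fulltopology)
qed

text \<open>
  The preimage under \<open>point_ideal R\<close> of the basic open set of the indicator of \<open>x\<close>
  is \<open>{x}\<close>.
\<close>
lemma discrete_if_point_ideal_continuous:
  assumes F: "R = function_ring (topspace X) F" "cring R"
    and ind: "\<And>x. x \<in> topspace X \<Longrightarrow> (\<lambda>y\<in>topspace X. if y = x then 1 else 0) \<in> F"
    and cont: "continuous_map X (hull_kernel_topology R) (point_ideal R)"
  shows "X = discrete_topology (topspace X)"
proof -
  have "openin X {x}" if x: "x \<in> topspace X" for x
  proof -
    let ?i = "\<lambda>y\<in>topspace X. if y = x then 1 else 0 :: real"
    have i: "?i \<in> carrier R"
      using ind[OF x] by (simp add: F(1) function_ring_def)
    have "openin X {y \<in> topspace X. point_ideal R y \<in> {M \<in> max_ideals R. ?i \<notin> M}}"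
      using cont openin_hull_kernel_base[OF F(2) i] by (rule openin_continuous_map_preimage)
    moreover have "{y \<in> topspace X. point_ideal R y \<in> {M \<in> max_ideals R. ?i \<notin> M}} = {x}"
    proof -
      have "point_ideal R y \<in> max_ideals R" if "y \<in> topspace X" for y
        using cont that topspace_hull_kernel[OF F(2)] by (auto simp: continuous_map_def)
      moreover have "?i \<notin> point_ideal R y \<longleftrightarrow> y = x" if "y \<in> topspace X" for y
        using i that by (auto simp: point_ideal_def)
      ultimately show ?thesis
        using x by blast
    qed
    ultimately show ?thesis
      by simp
  qed
  then show ?thesis
    by (metis discrete_topology_unique)
qed


section \<open>Discrete spaces\<close>

lemma continuous_funs_discrete: "continuous_funs (discrete_topology S) = extensional S"
  by (simp add: continuous_funs_def)

lemma baire_one_funs_discrete: "baire_one_funs (discrete_topology S) = extensional S"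
  by (auto simp: baire_one_funs_def continuous_funs_discrete)

lemma stone_cech_baire_one_discrete:
  "stone_cech_compactification TYPE('k) (discrete_topology S)
     (hull_kernel_topology (baire_one_ring (discrete_topology S)))
     (point_ideal (baire_one_ring (discrete_topology S)))"
proof -
  interpret locally_inverse_function_ring S "extensional S"
    by unfold_locales auto
  show ?thesis
    using stone_cech_maxspec by (simp add: baire_one_ring_def baire_one_funs_discrete)
qed

lemma stone_cech_bounded_baire_one_discrete:
  "stone_cech_compactification TYPE('k) (discrete_topology S)
     (hull_kernel_topology (bounded_baire_one_ring (discrete_topology S)))
     (point_ideal (bounded_baire_one_ring (discrete_topology S)))"
proof -
  interpret locally_inverse_function_ring S "{f \<in> extensional S. bounded (f ` S)}"
  proof
    show "(\<lambda>x\<in>S. c) \<in> {f \<in> extensional S. bounded (f ` S)}" for c :: real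
      by (auto simp: bounded_iff)
  next
    fix f g :: "'a \<Rightarrow> real"
    assume "f \<in> {f \<in> extensional S. bounded (f ` S)}" "g \<in> {f \<in> extensional S. bounded (f ` S)}"
    then obtain a b where ab: "\<And>x. x \<in> S \<Longrightarrow> \<bar>f x\<bar> \<le> a" "\<And>x. x \<in> S \<Longrightarrow> \<bar>g x\<bar> \<le> b"
      by (auto simp: bounded_iff)
    have "\<bar>f x + g x\<bar> \<le> a + b" if "x \<in> S" for x
      using ab[OF that] by linarith
    then show "(\<lambda>x\<in>S. f x + g x) \<in> {f \<in> extensional S. bounded (f ` S)}"
      by (auto simp: bounded_iff)
    have "\<bar>f x * g x\<bar> \<le> a * b" if "x \<in> S" for x
      using ab[OF that] by (simp add: abs_mult mult_mono')
    then show "(\<lambda>x\<in>S. f x * g x) \<in> {f \<in> extensional S. bounded (f ` S)}"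
      by (auto simp: bounded_iff)
  next
    fix f :: "'a \<Rightarrow> real" and B and c :: real
    assume "0 < c" and c: "\<And>x. x \<in> B \<inter> S \<Longrightarrow> c \<le> \<bar>f x\<bar>"
    have "\<bar>inverse (f x)\<bar> \<le> inverse c" if "x \<in> B \<inter> S" for x
      using c[OF that] \<open>0 < c\<close> le_imp_inverse_le[of c "\<bar>f x\<bar>"] by simp
    then have "norm y \<le> inverse c"
      if "y \<in> (\<lambda>x\<in>S. if x \<in> B then inverse (f x) else 0) ` S" for y
      using that \<open>0 < c\<close> by auto
    then show "(\<lambda>x\<in>S. if x \<in> B then inverse (f x) else 0) \<in> {f \<in> extensional S. bounded (f ` S)}"
      unfolding bounded_iff by blast
  qed auto
  show ?thesis
    using stone_cech_maxspec
    by (simp add: bounded_baire_one_ring_def bounded_baire_one_funs_def baire_one_funs_discrete)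
qed


section \<open>The equivalences\<close>

theorem theorem4p17:
  fixes X :: "'a topology"
  assumes "perfectly_normal_space X" and "t1_space X"
  shows
    "(X = discrete_topology (topspace X) \<longleftrightarrow> baire_one_funs X = continuous_funs X) \<and>
     (baire_one_funs X = continuous_funs X \<longleftrightarrow>
        bounded_baire_one_funs X = bounded_continuous_funs X) \<and>
     (bounded_baire_one_funs X = bounded_continuous_funs X \<longleftrightarrow>
        stone_cech_compactification TYPE(('a \<Rightarrow> real) set + 'k) X
          (hull_kernel_topology (bounded_baire_one_ring X))
          (point_ideal (bounded_baire_one_ring X))) \<and>
     (stone_cech_compactification TYPE(('a \<Rightarrow> real) set + 'k) X
          (hull_kernel_topology (bounded_baire_one_ring X))
          (point_ideal (bounded_baire_one_ring X)) \<longleftrightarrow>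
        stone_cech_compactification TYPE(('a \<Rightarrow> real) set + 'k) X
          (hull_kernel_topology (baire_one_ring X))
          (point_ideal (baire_one_ring X)))"
  (is "(?D \<longleftrightarrow> ?B) \<and> (?B \<longleftrightarrow> ?Bb) \<and> (?Bb \<longleftrightarrow> ?SCb) \<and> (?SCb \<longleftrightarrow> ?SC)")
proof -
  note ind = indicator_point_baire_one[OF assms]
  have 1: ?B if ?D
  proof -
    have "baire_one_funs (discrete_topology (topspace X)) = continuous_funs (discrete_topology (topspace X))"
      by (simp add: baire_one_funs_discrete continuous_funs_discrete)
    with that show ?thesis
      by metis
  qed
  have 2: ?Bb if ?B
    using that by (simp add: bounded_baire_one_funs_def bounded_continuous_funs_def)
  have 3: ?D if ?Bb
    using that by (intro discrete_if_bounded_baire_one_continuous[OF assms])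
      (auto simp: bounded_continuous_funs_def)
  have 4: ?SCb if ?D
    using stone_cech_bounded_baire_one_discrete[of "topspace X"] that by metis
  have 5: ?SC if ?D
    using stone_cech_baire_one_discrete[of "topspace X"] that by metis
  have 6: ?D if ?SCb
    using ind stone_cech_compactification_imp_continuous_map[OF that]
    by (intro discrete_if_point_ideal_continuous[OF bounded_baire_one_ring_def
          cring_bounded_baire_one_ring]) auto
  have 7: ?D if ?SC
    using ind stone_cech_compactification_imp_continuous_map[OF that]
    by (intro discrete_if_point_ideal_continuous[OF baire_one_ring_def cring_baire_one_ring])
      (auto simp: bounded_baire_one_funs_def)
  from 1 2 3 4 5 6 7 show ?thesis
    by blast
qed

end
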